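(* Let $R$ be a unital ring with involution $*$ and let $a\in R$. Then the following conditions are equivalent: (1) $a\in R^{\dagger}$; (2) $a$ is well-supported; (3) $a$ is co-supported.
   Context: $R$ is a unital ring with an involution $a\mapsto a^*$, i.e. $(a^* )^*=a$, $(ab)^*=b^*a^*$, $(a+b)^*=a^*+b^*$. $R^{\dagger}$ is the set of Moore-Penrose invertible elements, i.e. those $a$ for which there is $b\in R$ with $aba=a$, $bab=b$, $(ab)^*=ab$, $(ba)^*=ba$. A projection is an element $p$ with $p^2=p=p^*$. An element $a\in R$ is well-supported if there exists a projection $p\in R$ such that $ap=a$ and $a^{*}a+1-p$ is invertible. An element $a\in R$ is co-supported if there exists a projection $q\in R$ such that $qa=a$ and $aa^{*}+1-q$ is invertible. *)

theory Defs
  imports Main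
begin

(* The sort {ring, monoid_mult} rather than ring_1, because the latter excludes the zero ring. *)
class involution_ring = ring + monoid_mult +
  fixes invol :: "'a \<Rightarrow> 'a"
  assumes invol_invol: "invol (invol a) = a"
    and invol_mult: "invol (a * b) = invol b * invol a"
    and invol_add: "invol (a + b) = invol a + invol b"

(* Two-sided: a dvd 1 would give only a right inverse in a noncommutative ring. *)
definition invertible :: "'a::monoid_mult \<Rightarrow> bool" where
  "invertible a \<longleftrightarrow> (\<exists>b. a * b = 1 \<and> b * a = 1)"

definition projection :: "'a::involution_ring \<Rightarrow> bool" where
  "projection p \<longleftrightarrow> p\<^sup>2 = p \<and> p = invol p"

definition moore_penrose_inverse :: "'a::involution_ring \<Rightarrow> 'a \<Rightarrow> bool" where
  "moore_penrose_inverse a b \<longleftrightarrow>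
     a * b * a = a \<and> b * a * b = b \<and> invol (a * b) = a * b \<and> invol (b * a) = b * a"

definition moore_penrose_invertibles :: "'a::involution_ring set" where
  "moore_penrose_invertibles = {a. \<exists>b. moore_penrose_inverse a b}"

definition well_supported :: "'a::involution_ring \<Rightarrow> bool" where
  "well_supported a \<longleftrightarrow>
     (\<exists>p. projection p \<and> a * p = a \<and> invertible (invol a * a + 1 - p))"

definition co_supported :: "'a::involution_ring \<Rightarrow> bool" where
  "co_supported a \<longleftrightarrow>
     (\<exists>q. projection q \<and> q * a = a \<and> invertible (a * invol a + 1 - q))"

end

theory Submission
  imports Defs
begin

text \<open>
  The projection that supports \<open>a\<close> is \<open>b * a\<close>, where \<open>b\<close> is the Moore-Penrose inverse. Relative to
  \<open>p = b * a\<close> the element \<open>u = invol a * a + 1 - p\<close> is block diagonal: it is \<open>invol a * a\<close> on the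
  corner of \<open>p\<close>, with inverse \<open>b * invol b\<close> there, and the identity on the corner of \<open>1 - p\<close>. So \<open>u\<close>
  is invertible. Conversely, if such a \<open>p\<close> makes \<open>u\<close> invertible, then \<open>u\<close> is self-adjoint with
  \<open>u * p = invol a * a\<close>, and the usual formula for the least-squares inverse, \<open>b = v * invol a\<close> with
  \<open>v\<close> the inverse of \<open>u\<close>, gives \<open>b * a = p\<close>, from which the Penrose equations follow.

  Being co-supported is being well-supported for \<open>invol a\<close>, and \<open>a\<close> is Moore-Penrose invertible
  exactly when \<open>invol a\<close> is; this gives the third condition.
\<close>

lemma invol_one: "invol (1::'a::involution_ring) = 1"
  by (metis invol_invol invol_mult mult_1_right)

lemma invol_diff: "invol (a - b :: 'a::involution_ring) = invol a - invol b"
  by (metis invol_add add_diff_cancel diff_add_cancel)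

lemma invol_self_mult_plus_complement:
  fixes a p :: "'a::involution_ring"
  assumes "invol p = p"
  shows "invol (invol a * a + 1 - p) = invol a * a + 1 - p"
  by (simp add: assms invol_diff invol_add invol_mult invol_invol invol_one)

lemma inverse_of_self_adjoint:
  fixes u v :: "'a::involution_ring"
  assumes "invol u = u" "u * v = 1" "v * u = 1"
  shows "invol v = v"
proof -
  have "invol v * u = 1"
    by (metis assms(1,2) invol_mult invol_one)
  then show ?thesis
    by (metis assms(2) mult.assoc mult_1_left mult_1_right)
qed

text \<open>
  Since \<open>invol b\<close> is a Moore-Penrose inverse of \<open>invol a\<close>, the product \<open>b * invol b\<close> inverts
  \<open>invol a * a\<close> up to the projection \<open>p = b * a\<close>; adding \<open>1 - p\<close> to both factors turns this into
  an honest inverse, because \<open>a\<close> vanishes on \<open>1 - p\<close> from the right and \<open>b\<close> from the left.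
\<close>

lemma moore_penrose_imp_well_supported:
  fixes a b :: "'a::involution_ring"
  assumes "moore_penrose_inverse a b"
  shows "well_supported a"
proof -
  have aba: "a * b * a = a" and bab: "b * a * b = b"
    and ab: "invol (a * b) = a * b" and ba: "invol (b * a) = b * a"
    using assms by (auto simp: moore_penrose_inverse_def)
  define p where "p = b * a"
  have pp: "p * p = p" and ap: "a * p = a" and pb: "p * b = b" and p_sa: "invol p = p"
    using aba bab ba by (simp_all add: p_def mult.assoc [symmetric])
  let ?u = "invol a * a + 1 - p" and ?v = "b * invol b + 1 - p"
  have corner: "invol a * a * (b * invol b) = p"
  proof -
    have "invol a * a * (b * invol b) = invol a * (a * b) * invol b"
      by (simp add: mult.assoc)
    also have "\<dots> = invol (a * b * a) * invol b"
      by (metis ab invol_mult)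
    also have "\<dots> = p"
      by (metis aba ba invol_mult p_def)
    finally show ?thesis .
  qed
  have "?u * ?v = invol a * a * (b * invol b) + invol a * (a - a * p)
          + (b - p * b) * invol b + (1 - p - (p - p * p))"
    by (simp add: algebra_simps)
  then have uv: "?u * ?v = 1"
    by (simp add: corner ap pb pp)
  \<comment> \<open>Both factors are self-adjoint, so the adjoint of this identity is the reversed product.\<close>
  have "invol ?u = ?u" "invol ?v = ?v"
    using invol_self_mult_plus_complement [OF p_sa, of a]
      invol_self_mult_plus_complement [OF p_sa, of "invol b"]
    by (simp_all add: invol_invol)
  with uv have "?v * ?u = 1"
    by (metis invol_mult invol_one)
  with uv have "invertible ?u"
    unfolding invertible_def by blast
  moreover have "projection p"
    by (simp add: projection_def power2_eq_square pp p_sa)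
  ultimately show ?thesis
    using ap unfolding well_supported_def by blast
qed

text \<open>
  With \<open>b = v * invol a\<close> the product \<open>a * b\<close> is \<open>a * v * invol a\<close>, self-adjoint because \<open>v\<close> is,
  and \<open>b * a = v * u * p = p\<close> is self-adjoint by assumption. The two remaining equations say that
  \<open>p\<close> fixes \<open>a\<close> from the right and \<open>b\<close> from the left.
\<close>

lemma well_supported_imp_moore_penrose:
  fixes a :: "'a::involution_ring"
  assumes "well_supported a"
  shows "\<exists>b. moore_penrose_inverse a b"
proof -
  obtain p v where pp: "p * p = p" and p_sa: "invol p = p" and ap: "a * p = a"
    and uv: "(invol a * a + 1 - p) * v = 1" and vu: "v * (invol a * a + 1 - p) = 1"
    using assms
    unfolding well_supported_def projection_def invertible_def power2_eq_square by metis
  define u where "u = invol a * a + 1 - p"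
  have pa: "p * invol a = invol a"
    by (metis ap invol_mult p_sa)
  have up: "u * p = invol a * a"
    by (simp add: u_def algebra_simps ap pp)
  have pu: "p * u = invol a * a"
    by (simp add: u_def algebra_simps pp) (simp add: pa mult.assoc [symmetric])
  have v_sa: "invol v = v"
    using inverse_of_self_adjoint invol_self_mult_plus_complement [OF p_sa] uv vu by blast
  \<comment> \<open>The inverse of \<open>u\<close> commutes with everything that \<open>u\<close> commutes with, in particular with \<open>p\<close>.\<close>
  have vp: "v * p = p * v"
  proof -
    have "v * p = v * (p * u) * v"
      using uv by (simp add: u_def mult.assoc)
    also have "\<dots> = v * (u * p) * v"
      by (simp only: up pu)
    also have "\<dots> = p * v"
      using vu by (simp add: u_def mult.assoc [symmetric])
    finally show ?thesis .
  qed
  define b where "b = v * invol a"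
  have "b * a = v * (u * p)"
    by (simp add: b_def up mult.assoc)
  then have ba: "b * a = p"
    using vu by (simp add: u_def mult.assoc [symmetric])
  have "p * b = b"
    by (metis b_def mult.assoc pa vp)
  moreover have "invol (a * b) = a * b"
    by (simp add: b_def invol_mult invol_invol v_sa mult.assoc)
  ultimately have "moore_penrose_inverse a b"
    by (simp add: moore_penrose_inverse_def ba ap p_sa mult.assoc)
  then show ?thesis ..
qed

lemma moore_penrose_inverse_invol:
  fixes a b :: "'a::involution_ring"
  assumes "moore_penrose_inverse a b"
  shows "moore_penrose_inverse (invol a) (invol b)"
  using assms unfolding moore_penrose_inverse_def by (metis invol_mult mult.assoc)

lemma co_supported_iff_well_supported_invol:
  fixes a :: "'a::involution_ring"
  shows "co_supported a \<longleftrightarrow> well_supported (invol a)"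
proof -
  have "q * a = a \<longleftrightarrow> invol a * q = invol a" if "projection q" for q
    using that unfolding projection_def by (metis invol_invol invol_mult)
  then show ?thesis
    unfolding co_supported_def well_supported_def by (auto simp: invol_invol)
qed

theorem corollary3p8:
  fixes a :: "'a::involution_ring"
  shows "(a \<in> moore_penrose_invertibles \<longleftrightarrow> well_supported a) \<and>
         (well_supported a \<longleftrightarrow> co_supported a)"
proof -
  have ws: "well_supported c \<longleftrightarrow> (\<exists>b. moore_penrose_inverse c b)" for c :: 'a
    using moore_penrose_imp_well_supported well_supported_imp_moore_penrose by blast
  have "(\<exists>b. moore_penrose_inverse a b) \<longleftrightarrow> (\<exists>b. moore_penrose_inverse (invol a) b)"
    by (metis moore_penrose_inverse_invol invol_invol)
  then show ?thesis
    by (simp add: moore_penrose_invertibles_def ws co_supported_iff_well_supported_invol)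
qed

end
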